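(* Let $L:\mathscr A\to\mathscr B$ and $R:\mathscr B\to\mathscr A$ be functors between categories with $L\dashv R$, and let $F:\mathscr C\to\mathscr A$, $G:\mathscr B\to\mathscr C$ be functors forming an $R$-relative coadjunction, i.e. equipped with bijections $\Psi_{C,B}:\mathscr A(FC,RB)\cong\mathscr C(C,GB)$ natural in $C\in\mathscr C$ and $B\in\mathscr B$. Then this data induces a positive adjunction between $\mathscr C$ and the duploid $\mathbf{dupl}_{L,R}$, with left adjoint $F:\mathscr C\to\mathbf{dupl}_{L,R}$ and right adjoint the bare functor $G^-:\mathbf{dupl}_{L,R}\rightharpoonup\mathscr C$.
   Context: A non-associative category is a category without the associativity axiom (identities are still neutral). A bare functor $\mathscr D\rightharpoonup\mathscr E$ between non-associative categories is a morphism of reflexive graphs (preserves sources, targets and identities, not necessarily composition). A morphism $f$ is thunkable if $(h\circ g)\circ f=h\circ(g\circ f)$ for all composable $g,h$; $h$ is linear if $(h\circ g)\circ f=h\circ(g\circ f)$ for all composable $f,g$. An object $A$ is positive if every morphism with source $A$ is linear; negative if every morphism with target $A$ is thunkable. An adjunction over non-associative categories $\mathscr D,\mathscr E$ consists of bare functors $F:\mathscr D\rightharpoonup\mathscr E$, $G:\mathscr E\rightharpoonup\mathscr D$ and bijections $\varphi_{A,B}:\mathscr E(FA,B)\cong\mathscr D(A,GB)$ natural separately in each variable: $\varphi(g\circ h)=Gg\circ\varphi(h)$ and $\varphi(h\circ Ff)=\varphi(h)\circ f$ for all composable $g,h,f$. It is positive when $FA$ is a positive object for every $A$. The non-associative category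 $\mathbf{dupl}_{L,R}$: its objects are $|\mathscr A|\uplus|\mathscr B|$. For an object $X$ set $X^+=X$ if $X\in\mathscr A$, $X^+=RX$ if $X\in\mathscr B$; $X^-=LX$ if $X\in\mathscr A$, $X^-=X$ if $X\in\mathscr B$. Put $\mathbf{dupl}_{L,R}(X,Y)=\mathscr A(X^+,RY^-)$ (equivalently $\mathscr B(LX^+,Y^-)$). The identity on $X$ is the unit $\eta_X:X\to RLX$ if $X\in\mathscr A$ and $\mathrm{id}_{RX}$ if $X\in\mathscr B$. For $f\in\mathscr A(X^+,RZ^-)$ and $g\in\mathscr A(Z^+,RY^-)$, the composite is $R(\hat g)\circ f$ if $Z\in\mathscr A$, where $\hat g:LZ\to Y^-$ is the transpose of $g$, and is $g\circ f$ (composition in $\mathscr A$) if $Z\in\mathscr B$. The left adjoint $F:\mathscr C\to\mathbf{dupl}_{L,R}$ sends $C$ to $FC\in|\mathscr A|$ and $f:C\to C'$ to $\eta_{FC'}\circ Ff\in\mathscr A(FC,RLFC')$. The bare functor $G^-$: on objects $G^-X=G(X^-)$. On $f\in\mathbf{dupl}_{L,R}(X,Y)=\mathscr A(X^+,RY^-)$: if $X\in\mathscr A$, $G^-f=G(\hat f)$ with $\hat f:LX\to Y^-$ the transpose of $f$; if $X\in\mathscr B$, $G^-f=\Psi_{GX,Y^-}(f\circ\varepsilon_X)$, where $\varepsilon_X=\Psi_{GX,X}^{-1}(\mathrm{id}_{GX}):FGX\to RX$. *)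

theory Defs
  imports Main
begin

(* Hom-sets are indexed by source and target and need not be disjoint: in dupl below, one and
   the same arrow represents morphisms between different pairs of objects.  Hence composition
   and the arrow part of a functor take the objects as arguments.
   Comp D X Z Y g f is the composite g o f of f : X -> Z and g : Z -> Y. *)
record ('o, 'm) nacat =
  Obj :: "'o set"
  Hom :: "'o \<Rightarrow> 'o \<Rightarrow> 'm set"
  Id :: "'o \<Rightarrow> 'm"
  Comp :: "'o \<Rightarrow> 'o \<Rightarrow> 'o \<Rightarrow> 'm \<Rightarrow> 'm \<Rightarrow> 'm"

locale nonassoc_category =
  fixes D :: "('o, 'm) nacat"
  assumes Id_in_Hom: "X \<in> Obj D \<Longrightarrow> Id D X \<in> Hom D X X"
    and Comp_in_Hom:
      "\<lbrakk>X \<in> Obj D; Z \<in> Obj D; Y \<in> Obj D; f \<in> Hom D X Z; g \<in> Hom D Z Y\<rbrakk>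
        \<Longrightarrow> Comp D X Z Y g f \<in> Hom D X Y"
    and Comp_Id_left:
      "\<lbrakk>X \<in> Obj D; Y \<in> Obj D; f \<in> Hom D X Y\<rbrakk> \<Longrightarrow> Comp D X Y Y (Id D Y) f = f"
    and Comp_Id_right:
      "\<lbrakk>X \<in> Obj D; Y \<in> Obj D; f \<in> Hom D X Y\<rbrakk> \<Longrightarrow> Comp D X X Y f (Id D X) = f"

locale category = nonassoc_category +
  assumes Comp_assoc:
      "\<lbrakk>W \<in> Obj D; X \<in> Obj D; Y \<in> Obj D; Z \<in> Obj D;
        f \<in> Hom D W X; g \<in> Hom D X Y; h \<in> Hom D Y Z\<rbrakk>
        \<Longrightarrow> Comp D W X Z (Comp D X Y Z h g) f = Comp D W Y Z h (Comp D W X Y g f)"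

definition linear :: "('o, 'm) nacat \<Rightarrow> 'o \<Rightarrow> 'o \<Rightarrow> 'm \<Rightarrow> bool" where
  "linear D Y Z h \<longleftrightarrow>
    (\<forall>W\<in>Obj D. \<forall>X\<in>Obj D. \<forall>f\<in>Hom D W X. \<forall>g\<in>Hom D X Y.
      Comp D W X Z (Comp D X Y Z h g) f = Comp D W Y Z h (Comp D W X Y g f))"

definition positive_object :: "('o, 'm) nacat \<Rightarrow> 'o \<Rightarrow> bool" where
  "positive_object D A \<longleftrightarrow> A \<in> Obj D \<and> (\<forall>B\<in>Obj D. \<forall>h\<in>Hom D A B. linear D A B h)"

record ('o, 'm, 'p, 'n) fctr =
  ob :: "'o \<Rightarrow> 'p"
  ar :: "'o \<Rightarrow> 'o \<Rightarrow> 'm \<Rightarrow> 'n"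

locale bare_functor =
  D: nonassoc_category D + E: nonassoc_category E
  for D :: "('o, 'm) nacat" and E :: "('p, 'n) nacat" +
  fixes F :: "('o, 'm, 'p, 'n) fctr"
  assumes ob_in_Obj: "X \<in> Obj D \<Longrightarrow> ob F X \<in> Obj E"
    and ar_in_Hom:
      "\<lbrakk>X \<in> Obj D; Y \<in> Obj D; f \<in> Hom D X Y\<rbrakk> \<Longrightarrow> ar F X Y f \<in> Hom E (ob F X) (ob F Y)"
    and ar_Id: "X \<in> Obj D \<Longrightarrow> ar F X X (Id D X) = Id E (ob F X)"

locale cat_functor = bare_functor D E F + D: category D + E: category E
  for D :: "('o, 'm) nacat" and E :: "('p, 'n) nacat" and F :: "('o, 'm, 'p, 'n) fctr" +
  assumes ar_Comp:
      "\<lbrakk>X \<in> Obj D; Z \<in> Obj D; Y \<in> Obj D; f \<in> Hom D X Z; g \<in> Hom D Z Y\<rbrakk>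
        \<Longrightarrow> ar F X Y (Comp D X Z Y g f) =
            Comp E (ob F X) (ob F Z) (ob F Y) (ar F Z Y g) (ar F X Z f)"

(* When D and E are categories and F and G are functors, this is an ordinary adjunction. *)
locale adjunction = F: bare_functor D E F + G: bare_functor E D G
  for D :: "('o, 'm) nacat" and E :: "('p, 'n) nacat"
    and F :: "('o, 'm, 'p, 'n) fctr" and G :: "('p, 'n, 'o, 'm) fctr" +
  fixes \<phi> :: "'o \<Rightarrow> 'p \<Rightarrow> 'n \<Rightarrow> 'm"
  assumes bij:
      "\<lbrakk>A \<in> Obj D; B \<in> Obj E\<rbrakk> \<Longrightarrow> bij_betw (\<phi> A B) (Hom E (ob F A) B) (Hom D A (ob G B))"
    and natural_right:
      "\<lbrakk>A \<in> Obj D; B \<in> Obj E; B' \<in> Obj E; h \<in> Hom E (ob F A) B; g \<in> Hom E B B'\<rbrakk>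
        \<Longrightarrow> \<phi> A B' (Comp E (ob F A) B B' g h) =
            Comp D A (ob G B) (ob G B') (ar G B B' g) (\<phi> A B h)"
    and natural_left:
      "\<lbrakk>A' \<in> Obj D; A \<in> Obj D; B \<in> Obj E; f \<in> Hom D A' A; h \<in> Hom E (ob F A) B\<rbrakk>
        \<Longrightarrow> \<phi> A' B (Comp E (ob F A') (ob F A) B h (ar F A' A f)) =
            Comp D A' A (ob G B) (\<phi> A B h) f"

locale positive_adjunction = adjunction +
  assumes positive: "A \<in> Obj D \<Longrightarrow> positive_object E (ob F A)"

locale relative_coadjunction =
  R: cat_functor \<B> \<A> R + F: cat_functor \<C> \<A> F + G: cat_functor \<B> \<C> G
  for \<A> :: "('a, 'm) nacat" and \<B> :: "('b, 'n) nacat" and \<C> :: "('c, 'k) nacat"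
    and R :: "('b, 'n, 'a, 'm) fctr"
    and F :: "('c, 'k, 'a, 'm) fctr" and G :: "('b, 'n, 'c, 'k) fctr" +
  fixes \<Psi> :: "'c \<Rightarrow> 'b \<Rightarrow> 'm \<Rightarrow> 'k"
  assumes bij:
      "\<lbrakk>C \<in> Obj \<C>; B \<in> Obj \<B>\<rbrakk>
        \<Longrightarrow> bij_betw (\<Psi> C B) (Hom \<A> (ob F C) (ob R B)) (Hom \<C> C (ob G B))"
    and natural_right:
      "\<lbrakk>C \<in> Obj \<C>; B \<in> Obj \<B>; B' \<in> Obj \<B>; h \<in> Hom \<A> (ob F C) (ob R B); g \<in> Hom \<B> B B'\<rbrakk>
        \<Longrightarrow> \<Psi> C B' (Comp \<A> (ob F C) (ob R B) (ob R B') (ar R B B' g) h) =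
            Comp \<C> C (ob G B) (ob G B') (ar G B B' g) (\<Psi> C B h)"
    and natural_left:
      "\<lbrakk>C' \<in> Obj \<C>; C \<in> Obj \<C>; B \<in> Obj \<B>; f \<in> Hom \<C> C' C; h \<in> Hom \<A> (ob F C) (ob R B)\<rbrakk>
        \<Longrightarrow> \<Psi> C' B (Comp \<A> (ob F C') (ob F C) (ob R B) h (ar F C' C f)) =
            Comp \<C> C' C (ob G B) (\<Psi> C B h) f"

definition adj_unit ::
  "('b, 'n) nacat \<Rightarrow> ('a, 'm, 'b, 'n) fctr \<Rightarrow> ('a \<Rightarrow> 'b \<Rightarrow> 'n \<Rightarrow> 'm) \<Rightarrow> 'a \<Rightarrow> 'm"
where
  "adj_unit \<B> L \<phi> A = \<phi> A (ob L A) (Id \<B> (ob L A))"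

definition adj_transpose ::
  "('b, 'n) nacat \<Rightarrow> ('a, 'm, 'b, 'n) fctr \<Rightarrow> ('a \<Rightarrow> 'b \<Rightarrow> 'n \<Rightarrow> 'm) \<Rightarrow> 'a \<Rightarrow> 'b \<Rightarrow> 'm \<Rightarrow> 'n"
where
  "adj_transpose \<B> L \<phi> A B = inv_into (Hom \<B> (ob L A) B) (\<phi> A B)"

fun pos_part :: "('b, 'n, 'a, 'm) fctr \<Rightarrow> 'a + 'b \<Rightarrow> 'a" where
  "pos_part R (Inl A) = A"
| "pos_part R (Inr B) = ob R B"

fun neg_part :: "('a, 'm, 'b, 'n) fctr \<Rightarrow> 'a + 'b \<Rightarrow> 'b" where
  "neg_part L (Inl A) = ob L A"
| "neg_part L (Inr B) = B"

definition dupl ::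
  "('a, 'm) nacat \<Rightarrow> ('b, 'n) nacat \<Rightarrow> ('a, 'm, 'b, 'n) fctr \<Rightarrow> ('b, 'n, 'a, 'm) fctr \<Rightarrow>
    ('a \<Rightarrow> 'b \<Rightarrow> 'n \<Rightarrow> 'm) \<Rightarrow> ('a + 'b, 'm) nacat"
where
  "dupl \<A> \<B> L R \<phi> =
    \<lparr>Obj = Obj \<A> <+> Obj \<B>,
     Hom = (\<lambda>X Y. Hom \<A> (pos_part R X) (ob R (neg_part L Y))),
     Id = (\<lambda>X. case X of Inl A \<Rightarrow> adj_unit \<B> L \<phi> A | Inr B \<Rightarrow> Id \<A> (ob R B)),
     Comp = (\<lambda>X Z Y g f. case Z of
         Inl A \<Rightarrow> Comp \<A> (pos_part R X) (ob R (ob L A)) (ob R (neg_part L Y))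
           (ar R (ob L A) (neg_part L Y) (adj_transpose \<B> L \<phi> A (neg_part L Y) g)) f
       | Inr B \<Rightarrow> Comp \<A> (pos_part R X) (ob R B) (ob R (neg_part L Y)) g f)\<rparr>"

definition dupl_left ::
  "('a, 'm) nacat \<Rightarrow> ('b, 'n) nacat \<Rightarrow> ('a, 'm, 'b, 'n) fctr \<Rightarrow> ('b, 'n, 'a, 'm) fctr \<Rightarrow>
    ('a \<Rightarrow> 'b \<Rightarrow> 'n \<Rightarrow> 'm) \<Rightarrow> ('c, 'k, 'a, 'm) fctr \<Rightarrow> ('c, 'k, 'a + 'b, 'm) fctr"
where
  "dupl_left \<A> \<B> L R \<phi> F =
    \<lparr>ob = (\<lambda>C. Inl (ob F C)),
     ar = (\<lambda>C C' f. Comp \<A> (ob F C) (ob F C') (ob R (ob L (ob F C')))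
       (adj_unit \<B> L \<phi> (ob F C')) (ar F C C' f))\<rparr>"

definition rel_counit ::
  "('a, 'm) nacat \<Rightarrow> ('c, 'k) nacat \<Rightarrow> ('b, 'n, 'a, 'm) fctr \<Rightarrow> ('c, 'k, 'a, 'm) fctr \<Rightarrow>
    ('b, 'n, 'c, 'k) fctr \<Rightarrow> ('c \<Rightarrow> 'b \<Rightarrow> 'm \<Rightarrow> 'k) \<Rightarrow> 'b \<Rightarrow> 'm"
where
  "rel_counit \<A> \<C> R F G \<Psi> B =
    inv_into (Hom \<A> (ob F (ob G B)) (ob R B)) (\<Psi> (ob G B) B) (Id \<C> (ob G B))"

definition dupl_right ::
  "('a, 'm) nacat \<Rightarrow> ('b, 'n) nacat \<Rightarrow> ('c, 'k) nacat \<Rightarrow>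
    ('a, 'm, 'b, 'n) fctr \<Rightarrow> ('b, 'n, 'a, 'm) fctr \<Rightarrow> ('a \<Rightarrow> 'b \<Rightarrow> 'n \<Rightarrow> 'm) \<Rightarrow>
    ('c, 'k, 'a, 'm) fctr \<Rightarrow> ('b, 'n, 'c, 'k) fctr \<Rightarrow> ('c \<Rightarrow> 'b \<Rightarrow> 'm \<Rightarrow> 'k) \<Rightarrow>
    ('a + 'b, 'm, 'c, 'k) fctr"
where
  "dupl_right \<A> \<B> \<C> L R \<phi> F G \<Psi> =
    \<lparr>ob = (\<lambda>X. ob G (neg_part L X)),
     ar = (\<lambda>X Y f. case X of
         Inl A \<Rightarrow> ar G (ob L A) (neg_part L Y) (adj_transpose \<B> L \<phi> A (neg_part L Y) f)
       | Inr B \<Rightarrow> \<Psi> (ob G B) (neg_part L Y)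
           (Comp \<A> (ob F (ob G B)) (ob R B) (ob R (neg_part L Y))
             f (rel_counit \<A> \<C> R F G \<Psi> B)))\<rparr>"

end

theory Submission
  imports Defs
begin

text \<open>Everything reduces to two triangle identities: \<open>R g' \<circ> \<eta> = g\<close> for the adjunction, where \<open>g'\<close>
  is the transpose of \<open>g\<close>, and \<open>\<epsilon> \<circ> F (\<Psi> h) = h\<close> for the relative coadjunction.  The first one
  collapses composition with \<open>\<eta> \<circ> F f\<close> in the duploid to composition with \<open>F f\<close>, and the second
  one gives naturality of \<open>\<Psi>\<close> along arrows out of objects of \<open>\<B>\<close>.  Composition over an object of \<open>\<A>\<close>
  is postcomposition with \<open>R g'\<close>, and \<open>(R h' \<circ> g)' = h' \<circ> g'\<close>; hence the objects of \<open>\<A>\<close> are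
  positive.\<close>

section \<open>Unit and transposes of the adjunction between \<open>L\<close> and
  \<open>R\<close>\<close>

locale category_adjunction =
  A: category \<A> + B: category \<B> +
  L: cat_functor \<A> \<B> L + R: cat_functor \<B> \<A> R + adj: adjunction \<A> \<B> L R \<phi>
  for \<A> :: "('a, 'm) nacat" and \<B> :: "('b, 'n) nacat"
    and L :: "('a, 'm, 'b, 'n) fctr" and R :: "('b, 'n, 'a, 'm) fctr"
    and \<phi> :: "'a \<Rightarrow> 'b \<Rightarrow> 'n \<Rightarrow> 'm"
begin

abbreviation "\<eta> \<equiv> adj_unit \<B> L \<phi>"
abbreviation "adjunct \<equiv> adj_transpose \<B> L \<phi>"
abbreviation "duploid \<equiv> dupl \<A> \<B> L R \<phi>"

lemma unit_in_Hom [simp]: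
  assumes "A \<in> Obj \<A>"
  shows "\<eta> A \<in> Hom \<A> A (ob R (ob L A))"
  unfolding adj_unit_def
  using adj.bij[OF assms L.ob_in_Obj[OF assms]] B.Id_in_Hom[OF L.ob_in_Obj[OF assms]]
  by (rule bij_betw_apply)

lemma adjunct_in_Hom [simp]:
  assumes "A \<in> Obj \<A>" "B \<in> Obj \<B>" "f \<in> Hom \<A> A (ob R B)"
  shows "adjunct A B f \<in> Hom \<B> (ob L A) B"
  unfolding adj_transpose_def
  using bij_betw_apply[OF bij_betw_inv_into[OF adj.bij[OF assms(1,2)]] assms(3)] .

lemma adjunct_right_inverse:
  assumes "A \<in> Obj \<A>" "B \<in> Obj \<B>" "f \<in> Hom \<A> A (ob R B)"
  shows "\<phi> A B (adjunct A B f) = f"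
  unfolding adj_transpose_def
  using bij_betw_inv_into_right[OF adj.bij[OF assms(1,2)] assms(3)] .

lemma adjunct_left_inverse:
  assumes "A \<in> Obj \<A>" "B \<in> Obj \<B>" "g \<in> Hom \<B> (ob L A) B"
  shows "adjunct A B (\<phi> A B g) = g"
  unfolding adj_transpose_def
  using bij_betw_inv_into_left[OF adj.bij[OF assms(1,2)] assms(3)] .

lemma adjunct_unit:
  assumes "A \<in> Obj \<A>"
  shows "adjunct A (ob L A) (\<eta> A) = Id \<B> (ob L A)"
  using assms by (simp add: adj_unit_def adjunct_left_inverse L.ob_in_Obj B.Id_in_Hom)

text \<open>Naturality of \<open>\<phi>\<close> in its second argument, applied to the identity of
  \<open>L A\<close>, which \<open>\<phi>\<close> sends to the unit. This gives the right identity
  law of the duploid at objects of \<open>\<A>\<close>.\<close>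

lemma adjunct_triangle:
  assumes A: "A \<in> Obj \<A>" and B: "B \<in> Obj \<B>" and f: "f \<in> Hom \<A> A (ob R B)"
  shows "Comp \<A> A (ob R (ob L A)) (ob R B) (ar R (ob L A) B (adjunct A B f)) (\<eta> A) = f"
proof -
  have LA: "ob L A \<in> Obj \<B>" using A by (rule L.ob_in_Obj)
  have "f = \<phi> A B (Comp \<B> (ob L A) (ob L A) B (adjunct A B f) (Id \<B> (ob L A)))"
    using assms LA by (simp add: B.Comp_Id_right adjunct_right_inverse)
  also have "\<dots> = Comp \<A> A (ob R (ob L A)) (ob R B) (ar R (ob L A) B (adjunct A B f)) (\<eta> A)"
    unfolding adj_unit_def
    using assms LA by (simp add: adj.natural_right B.Id_in_Hom)
  finally show ?thesis ..
qed

text \<open>By naturality \<open>\<phi>\<close> sends the right-hand side to the arrow being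
  transposed on the left, and transposition inverts \<open>\<phi>\<close>.\<close>

lemma adjunct_Comp:
  assumes A: "A \<in> Obj \<A>" and B: "B \<in> Obj \<B>" and B': "B' \<in> Obj \<B>"
    and f: "f \<in> Hom \<A> A (ob R B)" and g: "g \<in> Hom \<B> B B'"
  shows "adjunct A B' (Comp \<A> A (ob R B) (ob R B') (ar R B B' g) f) =
    Comp \<B> (ob L A) B B' g (adjunct A B f)"
proof -
  let ?g = "Comp \<B> (ob L A) B B' g (adjunct A B f)"
  have "\<phi> A B' ?g = Comp \<A> A (ob R B) (ob R B') (ar R B B' g) f"
    using assms by (simp add: adj.natural_right adjunct_right_inverse)
  moreover have "?g \<in> Hom \<B> (ob L A) B'"
    using assms by (auto intro!: B.Comp_in_Hom L.ob_in_Obj)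
  ultimately show ?thesis
    using adjunct_left_inverse[OF A B'] by metis
qed

section \<open>The duploid as a non-associative category, and its positive objects\<close>

lemma pos_part_in_Obj [simp]: "X \<in> Obj duploid \<Longrightarrow> pos_part R X \<in> Obj \<A>"
  by (auto simp: dupl_def R.ob_in_Obj)

lemma neg_part_in_Obj [simp]: "X \<in> Obj duploid \<Longrightarrow> neg_part L X \<in> Obj \<B>"
  by (auto simp: dupl_def L.ob_in_Obj)

lemma Inl_in_Obj_dupl [simp]: "Inl A \<in> Obj duploid \<longleftrightarrow> A \<in> Obj \<A>"
  by (auto simp: dupl_def)

lemma Inr_in_Obj_dupl [simp]: "Inr B \<in> Obj duploid \<longleftrightarrow> B \<in> Obj \<B>"
  by (auto simp: dupl_def)

lemma Hom_dupl [simp]: "Hom duploid X Y = Hom \<A> (pos_part R X) (ob R (neg_part L Y))"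
  by (simp add: dupl_def)

lemma Id_dupl [simp]:
  "Id duploid (Inl A) = \<eta> A"
  "Id duploid (Inr B) = Id \<A> (ob R B)"
  by (simp_all add: dupl_def)

lemma Comp_dupl [simp]:
  "Comp duploid X (Inl A) Y g f = Comp \<A> (pos_part R X) (ob R (ob L A)) (ob R (neg_part L Y))
    (ar R (ob L A) (neg_part L Y) (adjunct A (neg_part L Y) g)) f"
  "Comp duploid X (Inr B) Y g f = Comp \<A> (pos_part R X) (ob R B) (ob R (neg_part L Y)) g f"
  by (simp_all add: dupl_def)

lemma ar_adjunct_in_Hom [simp]:
  assumes "A \<in> Obj \<A>" "B \<in> Obj \<B>" "f \<in> Hom \<A> A (ob R B)"
  shows "ar R (ob L A) B (adjunct A B f) \<in> Hom \<A> (ob R (ob L A)) (ob R B)"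
  using assms by (simp add: R.ar_in_Hom L.ob_in_Obj)

lemma nonassoc_category_dupl: "nonassoc_category duploid"
proof
  fix X assume "X \<in> Obj duploid"
  then show "Id duploid X \<in> Hom duploid X X"
    by (cases X) (simp_all add: A.Id_in_Hom R.ob_in_Obj)
next
  fix X Z Y f g
  assume "X \<in> Obj duploid" "Z \<in> Obj duploid" "Y \<in> Obj duploid"
    and "f \<in> Hom duploid X Z" "g \<in> Hom duploid Z Y"
  then show "Comp duploid X Z Y g f \<in> Hom duploid X Y"
    by (cases Z) (auto intro!: A.Comp_in_Hom[of "pos_part R X"] R.ob_in_Obj L.ob_in_Obj)
next
  fix X Y f
  assume "X \<in> Obj duploid" "Y \<in> Obj duploid" "f \<in> Hom duploid X Y"
  then show "Comp duploid X Y Y (Id duploid Y) f = f"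
    \<comment> \<open>At an object \<open>A\<close> of \<open>\<A>\<close> the transpose of the unit
      is the identity of \<open>L A\<close>, which \<open>R\<close> preserves.\<close>
    by (cases Y)
      (simp_all add: adjunct_unit R.ar_Id L.ob_in_Obj R.ob_in_Obj A.Comp_Id_left)
next
  fix X Y f
  assume "X \<in> Obj duploid" "Y \<in> Obj duploid" "f \<in> Hom duploid X Y"
  then show "Comp duploid X X Y f (Id duploid X) = f"
    by (cases X) (simp_all add: adjunct_triangle R.ob_in_Obj A.Comp_Id_right)
qed

lemma positive_object_Inl:
  assumes A: "A \<in> Obj \<A>"
  shows "positive_object duploid (Inl A)"
  unfolding positive_object_def linear_def
proof (intro conjI ballI)
  show "Inl A \<in> Obj duploid" using A by simp
next
  fix Z h W X f g
  assume Z: "Z \<in> Obj duploid" and h: "h \<in> Hom duploid (Inl A) Z"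
    and W: "W \<in> Obj duploid" and X: "X \<in> Obj duploid"
    and f: "f \<in> Hom duploid W X" and g: "g \<in> Hom duploid X (Inl A)"
  let ?h = "adjunct A (neg_part L Z) h"
  have LA: "ob L A \<in> Obj \<B>" using A by (rule L.ob_in_Obj)
  show "Comp duploid W X Z (Comp duploid X (Inl A) Z h g) f =
    Comp duploid W (Inl A) Z h (Comp duploid W X (Inl A) g f)"
  proof (cases X)
    \<comment> \<open>Write \<open>h'\<close> and \<open>g'\<close> for the transposes. Both sides
      equal \<open>R h' o R g' o f\<close>: the left one because the transpose of
      \<open>R h' o g\<close> is \<open>h' o g'\<close>, the right one by associativity in
      \<open>\<A>\<close>.\<close>
    case (Inl A')
    then show ?thesis
      using A LA Z h W X f g
      by (simp add: adjunct_Comp R.ar_Comp L.ob_in_Obj A.Comp_assoc R.ob_in_Obj)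
  next
    \<comment> \<open>Composition over \<open>B\<close> is that of \<open>\<A>\<close>, so this is
      associativity of \<open>R h'\<close>, \<open>g\<close> and \<open>f\<close> in
      \<open>\<A>\<close>.\<close>
    case (Inr B)
    then show ?thesis
      using A LA Z h W X f g
      by (simp add: A.Comp_assoc R.ob_in_Obj)
  qed
qed

end

section \<open>The counit of the relative coadjunction\<close>

context relative_coadjunction
begin

abbreviation "\<epsilon> \<equiv> rel_counit \<A> \<C> R F G \<Psi>"

lemma rel_counit_in_Hom [simp]:
  assumes "B \<in> Obj \<B>"
  shows "\<epsilon> B \<in> Hom \<A> (ob F (ob G B)) (ob R B)"
  unfolding rel_counit_def
  using bij_betw_inv_into[OF bij[OF G.ob_in_Obj[OF assms] assms]]
    F.D.Id_in_Hom[OF G.ob_in_Obj[OF assms]]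
  by (rule bij_betw_apply)

lemma rel_counit_right_inverse:
  assumes "B \<in> Obj \<B>"
  shows "\<Psi> (ob G B) B (\<epsilon> B) = Id \<C> (ob G B)"
  unfolding rel_counit_def
  using bij_betw_inv_into_right[OF bij[OF G.ob_in_Obj[OF assms] assms]
    F.D.Id_in_Hom[OF G.ob_in_Obj[OF assms]]] .

lemma \<Psi>_in_Hom:
  assumes "C \<in> Obj \<C>" "B \<in> Obj \<B>" "h \<in> Hom \<A> (ob F C) (ob R B)"
  shows "\<Psi> C B h \<in> Hom \<C> C (ob G B)"
  using bij[OF assms(1,2)] assms(3) by (rule bij_betw_apply)

text \<open>\<open>\<Psi>\<close> is injective, and by naturality in \<open>\<C>\<close> it sends
  the composite to \<open>\<Psi> (\<epsilon> B) o \<Psi> h\<close>, whose first factor is an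
  identity.\<close>

lemma rel_counit_triangle:
  assumes C: "C \<in> Obj \<C>" and B: "B \<in> Obj \<B>" and h: "h \<in> Hom \<A> (ob F C) (ob R B)"
  shows "Comp \<A> (ob F C) (ob F (ob G B)) (ob R B) (\<epsilon> B) (ar F C (ob G B) (\<Psi> C B h)) = h"
proof -
  let ?h = "Comp \<A> (ob F C) (ob F (ob G B)) (ob R B) (\<epsilon> B) (ar F C (ob G B) (\<Psi> C B h))"
  have GB: "ob G B \<in> Obj \<C>" using B by (rule G.ob_in_Obj)
  have \<Psi>h: "\<Psi> C B h \<in> Hom \<C> C (ob G B)" using assms by (rule \<Psi>_in_Hom)
  have "\<Psi> C B ?h = \<Psi> C B h"
    using C B GB \<Psi>h by (simp add: natural_left rel_counit_right_inverse F.D.Comp_Id_left)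
  moreover have "?h \<in> Hom \<A> (ob F C) (ob R B)"
    using C B GB \<Psi>h
    by (auto intro!: R.E.Comp_in_Hom[of "ob F C" "ob F (ob G B)"] F.ob_in_Obj R.ob_in_Obj F.ar_in_Hom)
  ultimately show ?thesis
    using bij_betw_imp_inj_on[OF bij[OF C B]] h by (auto dest: inj_onD)
qed

text \<open>Since \<open>g\<close> is any arrow of \<open>\<A>\<close> from \<open>R B\<close> to
  \<open>R B'\<close>, not necessarily the image of one under \<open>R\<close>,
  \<open>natural_right\<close> does not apply. Instead \<open>h\<close> is factored as
  \<open>\<epsilon> B o F (\<Psi> h)\<close>; after reassociating, naturality in \<open>\<C>\<close>
  is enough.\<close>

lemma \<Psi>_Comp:
  assumes C: "C \<in> Obj \<C>" and B: "B \<in> Obj \<B>" and B': "B' \<in> Obj \<B>"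
    and h: "h \<in> Hom \<A> (ob F C) (ob R B)" and g: "g \<in> Hom \<A> (ob R B) (ob R B')"
  shows "\<Psi> C B' (Comp \<A> (ob F C) (ob R B) (ob R B') g h) =
    Comp \<C> C (ob G B) (ob G B')
      (\<Psi> (ob G B) B' (Comp \<A> (ob F (ob G B)) (ob R B) (ob R B') g (\<epsilon> B))) (\<Psi> C B h)"
proof -
  have obs: "ob G B \<in> Obj \<C>" "ob F C \<in> Obj \<A>" "ob F (ob G B) \<in> Obj \<A>"
      "ob R B \<in> Obj \<A>" "ob R B' \<in> Obj \<A>"
    using C B B' by (simp_all add: G.ob_in_Obj F.ob_in_Obj R.ob_in_Obj)
  have \<Psi>h: "\<Psi> C B h \<in> Hom \<C> C (ob G B)" using C B h by (rule \<Psi>_in_Hom)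
  let ?g = "Comp \<A> (ob F (ob G B)) (ob R B) (ob R B') g (\<epsilon> B)"
  have "Comp \<A> (ob F C) (ob R B) (ob R B') g h =
      Comp \<A> (ob F C) (ob F (ob G B)) (ob R B') ?g (ar F C (ob G B) (\<Psi> C B h))"
    using C B g obs \<Psi>h
    by (simp add: R.E.Comp_assoc F.ar_in_Hom rel_counit_triangle[OF C B h])
  moreover have "?g \<in> Hom \<A> (ob F (ob G B)) (ob R B')"
    using B g obs by (auto intro!: R.E.Comp_in_Hom[of _ "ob R B"])
  ultimately show ?thesis
    using C B' obs \<Psi>h by (simp add: natural_left)
qed

end

section \<open>The induced positive adjunction\<close>

theorem proposition33:
  fixes \<A> :: "('a, 'm) nacat" and \<B> :: "('b, 'n) nacat" and \<C> :: "('c, 'k) nacat"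
    and L :: "('a, 'm, 'b, 'n) fctr" and R :: "('b, 'n, 'a, 'm) fctr"
    and \<phi> :: "'a \<Rightarrow> 'b \<Rightarrow> 'n \<Rightarrow> 'm"
    and F :: "('c, 'k, 'a, 'm) fctr" and G :: "('b, 'n, 'c, 'k) fctr"
    and \<Psi> :: "'c \<Rightarrow> 'b \<Rightarrow> 'm \<Rightarrow> 'k"
  assumes "category \<A>" and "category \<B>" and "category \<C>"
    and "cat_functor \<A> \<B> L" and "cat_functor \<B> \<A> R"
    and "adjunction \<A> \<B> L R \<phi>"
    and "cat_functor \<C> \<A> F" and "cat_functor \<B> \<C> G"
    and "relative_coadjunction \<A> \<B> \<C> R F G \<Psi>"
  shows "positive_adjunction \<C> (dupl \<A> \<B> L R \<phi>)
    (dupl_left \<A> \<B> L R \<phi> F) (dupl_right \<A> \<B> \<C> L R \<phi> F G \<Psi>)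
    (\<lambda>C X. \<Psi> C (neg_part L X))"
proof -
  interpret category_adjunction \<A> \<B> L R \<phi>
    using assms by (intro category_adjunction.intro)
  interpret \<Psi>: relative_coadjunction \<A> \<B> \<C> R F G \<Psi> by fact
  interpret D: nonassoc_category duploid by (rule nonassoc_category_dupl)
  let ?F = "dupl_left \<A> \<B> L R \<phi> F" and ?G = "dupl_right \<A> \<B> \<C> L R \<phi> F G \<Psi>"
  have ob_F [simp]: "ob ?F C = Inl (ob F C)" for C
    by (simp add: dupl_left_def)
  have ar_F [simp]: "ar ?F C C' f =
      Comp \<A> (ob F C) (ob F C') (ob R (ob L (ob F C'))) (\<eta> (ob F C')) (ar F C C' f)" for C C' f
    by (simp add: dupl_left_def)
  have ob_G [simp]: "ob ?G X = ob G (neg_part L X)" for X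
    by (simp add: dupl_right_def)
  have ar_G [simp]:
    "ar ?G (Inl A) Y f = ar G (ob L A) (neg_part L Y) (adjunct A (neg_part L Y) f)"
    "ar ?G (Inr B) Y f = \<Psi> (ob G B) (neg_part L Y)
      (Comp \<A> (ob F (ob G B)) (ob R B) (ob R (neg_part L Y)) f (\<Psi>.\<epsilon> B))" for A B Y f
    by (simp_all add: dupl_right_def)
  note obs [simp] = L.ob_in_Obj R.ob_in_Obj \<Psi>.F.ob_in_Obj \<Psi>.G.ob_in_Obj
  show ?thesis
  proof
    fix C assume "C \<in> Obj \<C>"
    then show "ob ?F C \<in> Obj duploid" by simp
  next
    fix C C' f assume "C \<in> Obj \<C>" "C' \<in> Obj \<C>" "f \<in> Hom \<C> C C'"
    then show "ar ?F C C' f \<in> Hom duploid (ob ?F C) (ob ?F C')"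
      by (auto intro!: A.Comp_in_Hom[of "ob F C" "ob F C'"] \<Psi>.F.ar_in_Hom)
  next
    fix C assume "C \<in> Obj \<C>"
    then show "ar ?F C C (Id \<C> C) = Id duploid (ob ?F C)"
      by (simp add: \<Psi>.F.ar_Id A.Comp_Id_right)
  next
    fix X assume "X \<in> Obj duploid"
    then show "ob ?G X \<in> Obj \<C>" by simp
  next
    fix X Y f assume "X \<in> Obj duploid" "Y \<in> Obj duploid" "f \<in> Hom duploid X Y"
    then show "ar ?G X Y f \<in> Hom \<C> (ob ?G X) (ob ?G Y)"
      by (cases X) (auto intro!: \<Psi>.G.ar_in_Hom \<Psi>.\<Psi>_in_Hom
          A.Comp_in_Hom[of "ob F (ob G B)" "ob R B" for B])
  next
    fix X assume "X \<in> Obj duploid"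
    \<comment> \<open>At \<open>Inl A\<close> this is \<open>G\<close> applied to the transpose of
      the unit; at \<open>Inr B\<close> it is \<open>\<Psi>\<close> applied to the counit.\<close>
    then show "ar ?G X X (Id duploid X) = Id \<C> (ob ?G X)"
      by (cases X) (simp_all add: adjunct_unit \<Psi>.G.ar_Id \<Psi>.rel_counit_right_inverse A.Comp_Id_left)
  next
    \<comment> \<open>\<open>F C\<close> is its own positive part, so the hom-set from it to
      \<open>X\<close> is already \<open>\<A>(F C, R X^-)\<close>, the domain of
      \<open>\<Psi>\<close> at \<open>X^-\<close>.\<close>
    fix C X assume "C \<in> Obj \<C>" "X \<in> Obj duploid"
    then show "bij_betw (\<Psi> C (neg_part L X)) (Hom duploid (ob ?F C) X) (Hom \<C> C (ob ?G X))"
      by (simp add: \<Psi>.bij)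
  next
    fix C X Y h g
    assume *: "C \<in> Obj \<C>" "X \<in> Obj duploid" "Y \<in> Obj duploid"
      "h \<in> Hom duploid (ob ?F C) X" "g \<in> Hom duploid X Y"
    show "\<Psi> C (neg_part L Y) (Comp duploid (ob ?F C) X Y g h) =
      Comp \<C> C (ob ?G X) (ob ?G Y) (ar ?G X Y g) (\<Psi> C (neg_part L X) h)"
    proof (cases X)
      \<comment> \<open>With \<open>g'\<close> the transpose of \<open>g\<close>, the composite is
        \<open>R g' o h\<close> and \<open>G^- g = G g'\<close>, so naturality of
        \<open>\<Psi>\<close> in \<open>\<B>\<close> applies.\<close>
      case (Inl A)
      with * show ?thesis by (simp add: \<Psi>.natural_right)
    next
      case (Inr B)
      with * show ?thesis by (simp add: \<Psi>.\<Psi>_Comp[of C B "neg_part L Y" h g])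
    qed
  next
    fix C' C X f h
    assume C': "C' \<in> Obj \<C>" and C: "C \<in> Obj \<C>" and X: "X \<in> Obj duploid"
      and f: "f \<in> Hom \<C> C' C" and h: "h \<in> Hom duploid (ob ?F C) X"
    \<comment> \<open>The left side is \<open>R h' o (\<eta> o F f)\<close> with \<open>h'\<close>
      the transpose of \<open>h\<close>; reassociated, the triangle identity turns
      \<open>R h' o \<eta>\<close> into \<open>h\<close>.\<close>
    have "Comp duploid (ob ?F C') (ob ?F C) X h (ar ?F C' C f) =
        Comp \<A> (ob F C') (ob F C) (ob R (neg_part L X)) h (ar F C' C f)"
      using C' C X f h by (simp add: A.Comp_assoc[symmetric] \<Psi>.F.ar_in_Hom adjunct_triangle)
    then show "\<Psi> C' (neg_part L X) (Comp duploid (ob ?F C') (ob ?F C) X h (ar ?F C' C f)) =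
      Comp \<C> C' C (ob ?G X) (\<Psi> C (neg_part L X) h) f"
      using C' C X f h by (simp add: \<Psi>.natural_left)
  next
    fix C assume "C \<in> Obj \<C>"
    then show "positive_object duploid (ob ?F C)" by (simp add: positive_object_Inl)
  qed
qed

end
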